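(* Let $E: 0\to A\to H\xrightarrow{\phi} L\to 0$ be a universal central extension of diassociative algebras. Then both $H$ and $L$ are perfect.
   Context: All algebras are over a fixed field $\mathbb{F}$. A diassociative algebra is a vector space $L$ with two bilinear associative products $\dashv,\vdash$ satisfying, for all $x,y,z\in L$: $x\dashv(y\dashv z)=x\dashv(y\vdash z)$, $(x\vdash y)\dashv z=x\vdash(y\dashv z)$, $(x\dashv y)\vdash z=(x\vdash y)\vdash z$. Homomorphisms are linear maps preserving both products. For subalgebras $S,T$ of $L$, $S\lozenge T=S\dashv T+S\vdash T$ (linear span of all products $s\dashv t$ and $s\vdash t$). $L'=L\lozenge L$, and $L$ is perfect if $L=L'$. The center $Z(L)$ is the set of $z\in L$ with $z\dashv x=x\dashv z=z\vdash x=x\vdash z=0$ for all $x\in L$. An extension of $A$ by $L$ is a short exact sequence $0\to A\to H\xrightarrow{\phi} L\to 0$ of diassociative algebras and homomorphisms, where the map $A\to H$ is taken to be the inclusion (so $A=\ker\phi$). It is central if $A\subseteq Z(H)$; it is then called a central extension of $L$. A central extension $E:0\to A\to H\xrightarrow{\phi} L\to 0$ covers a central extension $E_1:0\to A_1\to H_1\xrightarrow{\phi_1} L\to 0$ if there is a homomorphism $\tau:H\to H_1$ making the diagram with vertical maps $\tau|_A,\tau,\mathrm{id}_L$ commute (i.e. $\phi_1\circ\tau=\phi$); it uniquely covers $E_1$ if moreover such $\tau$ is unique. A central extension $E$ of $L$ is universal if it uniquely covers every central extension of $L$. *)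

theory Defs
  imports "HOL-Algebra.Module" "HOL-Algebra.AbelCoset" "HOL.Hull"
begin

text \<open>
  A diassociative algebra is an HOL-Algebra module over a field with two further products.
  The ring fields \<open>mult\<close> and \<open>one\<close> that every HOL-Algebra module record carries are unused,
  as they are in \<^locale>\<open>module\<close>.
\<close>

record ('f, 'a) dialgebra = "('f, 'a) module" +
  lprod :: "'a \<Rightarrow> 'a \<Rightarrow> 'a"  (infixl \<open>\<stileturn>\<index>\<close> 70)
  rprod :: "'a \<Rightarrow> 'a \<Rightarrow> 'a"  (infixl \<open>\<turnstile>\<index>\<close> 70)

locale diassociative_algebra = field F + module F L
  for F :: "('f, 'r) ring_scheme" and L :: "('f, 'a) dialgebra" (structure) +
  assumes lprod_closed: "\<lbrakk>x \<in> carrier L; y \<in> carrier L\<rbrakk> \<Longrightarrow> x \<stileturn> y \<in> carrier L"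
    and rprod_closed: "\<lbrakk>x \<in> carrier L; y \<in> carrier L\<rbrakk> \<Longrightarrow> x \<turnstile> y \<in> carrier L"
    and lprod_add_left: "\<lbrakk>x \<in> carrier L; y \<in> carrier L; z \<in> carrier L\<rbrakk>
      \<Longrightarrow> (x \<oplus> y) \<stileturn> z = (x \<stileturn> z) \<oplus> (y \<stileturn> z)"
    and lprod_add_right: "\<lbrakk>x \<in> carrier L; y \<in> carrier L; z \<in> carrier L\<rbrakk>
      \<Longrightarrow> x \<stileturn> (y \<oplus> z) = (x \<stileturn> y) \<oplus> (x \<stileturn> z)"
    and rprod_add_left: "\<lbrakk>x \<in> carrier L; y \<in> carrier L; z \<in> carrier L\<rbrakk>
      \<Longrightarrow> (x \<oplus> y) \<turnstile> z = (x \<turnstile> z) \<oplus> (y \<turnstile> z)"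
    and rprod_add_right: "\<lbrakk>x \<in> carrier L; y \<in> carrier L; z \<in> carrier L\<rbrakk>
      \<Longrightarrow> x \<turnstile> (y \<oplus> z) = (x \<turnstile> y) \<oplus> (x \<turnstile> z)"
    and lprod_smult_left: "\<lbrakk>c \<in> carrier F; x \<in> carrier L; y \<in> carrier L\<rbrakk>
      \<Longrightarrow> (c \<odot> x) \<stileturn> y = c \<odot> (x \<stileturn> y)"
    and lprod_smult_right: "\<lbrakk>c \<in> carrier F; x \<in> carrier L; y \<in> carrier L\<rbrakk>
      \<Longrightarrow> x \<stileturn> (c \<odot> y) = c \<odot> (x \<stileturn> y)"
    and rprod_smult_left: "\<lbrakk>c \<in> carrier F; x \<in> carrier L; y \<in> carrier L\<rbrakk>
      \<Longrightarrow> (c \<odot> x) \<turnstile> y = c \<odot> (x \<turnstile> y)"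
    and rprod_smult_right: "\<lbrakk>c \<in> carrier F; x \<in> carrier L; y \<in> carrier L\<rbrakk>
      \<Longrightarrow> x \<turnstile> (c \<odot> y) = c \<odot> (x \<turnstile> y)"
    and lprod_assoc: "\<lbrakk>x \<in> carrier L; y \<in> carrier L; z \<in> carrier L\<rbrakk>
      \<Longrightarrow> (x \<stileturn> y) \<stileturn> z = x \<stileturn> (y \<stileturn> z)"
    and rprod_assoc: "\<lbrakk>x \<in> carrier L; y \<in> carrier L; z \<in> carrier L\<rbrakk>
      \<Longrightarrow> (x \<turnstile> y) \<turnstile> z = x \<turnstile> (y \<turnstile> z)"
    and lprod_lprod_eq_lprod_rprod: "\<lbrakk>x \<in> carrier L; y \<in> carrier L; z \<in> carrier L\<rbrakk>
      \<Longrightarrow> x \<stileturn> (y \<stileturn> z) = x \<stileturn> (y \<turnstile> z)"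
    and rprod_lprod_assoc: "\<lbrakk>x \<in> carrier L; y \<in> carrier L; z \<in> carrier L\<rbrakk>
      \<Longrightarrow> (x \<turnstile> y) \<stileturn> z = x \<turnstile> (y \<stileturn> z)"
    and lprod_rprod_eq_rprod_rprod: "\<lbrakk>x \<in> carrier L; y \<in> carrier L; z \<in> carrier L\<rbrakk>
      \<Longrightarrow> (x \<stileturn> y) \<turnstile> z = (x \<turnstile> y) \<turnstile> z"

definition dia_hom ::
  "('f, 'r) ring_scheme \<Rightarrow> ('f, 'a) dialgebra \<Rightarrow> ('f, 'b) dialgebra \<Rightarrow> ('a \<Rightarrow> 'b) set" where
  "dia_hom F L M = {h. h \<in> carrier L \<rightarrow> carrier M \<and>
     (\<forall>x\<in>carrier L. \<forall>y\<in>carrier L. h (x \<oplus>\<^bsub>L\<^esub> y) = h x \<oplus>\<^bsub>M\<^esub> h y) \<and>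
     (\<forall>c\<in>carrier F. \<forall>x\<in>carrier L. h (c \<odot>\<^bsub>L\<^esub> x) = c \<odot>\<^bsub>M\<^esub> h x) \<and>
     (\<forall>x\<in>carrier L. \<forall>y\<in>carrier L. h (x \<stileturn>\<^bsub>L\<^esub> y) = h x \<stileturn>\<^bsub>M\<^esub> h y) \<and>
     (\<forall>x\<in>carrier L. \<forall>y\<in>carrier L. h (x \<turnstile>\<^bsub>L\<^esub> y) = h x \<turnstile>\<^bsub>M\<^esub> h y)}"

definition lozenge ::
  "('f, 'r) ring_scheme \<Rightarrow> ('f, 'a) dialgebra \<Rightarrow> 'a set \<Rightarrow> 'a set \<Rightarrow> 'a set" where
  "lozenge F L S T = (\<lambda>N. submodule N F L) hull
     ({s \<stileturn>\<^bsub>L\<^esub> t | s t. s \<in> S \<and> t \<in> T} \<union> {s \<turnstile>\<^bsub>L\<^esub> t | s t. s \<in> S \<and> t \<in> T})"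

definition perfect :: "('f, 'r) ring_scheme \<Rightarrow> ('f, 'a) dialgebra \<Rightarrow> bool" where
  "perfect F L \<longleftrightarrow> carrier L = lozenge F L (carrier L) (carrier L)"

definition dia_center :: "('f, 'a) dialgebra \<Rightarrow> 'a set" where
  "dia_center L = {z \<in> carrier L. \<forall>x\<in>carrier L.
     z \<stileturn>\<^bsub>L\<^esub> x = \<zero>\<^bsub>L\<^esub> \<and> x \<stileturn>\<^bsub>L\<^esub> z = \<zero>\<^bsub>L\<^esub> \<and> z \<turnstile>\<^bsub>L\<^esub> x = \<zero>\<^bsub>L\<^esub> \<and> x \<turnstile>\<^bsub>L\<^esub> z = \<zero>\<^bsub>L\<^esub>}"

text \<open>
  The map from \<open>A\<close> to \<open>H\<close> in an extension is the inclusion, so \<open>A\<close> is a subset of the carrier of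
  \<open>H\<close> with the inherited operations; exactness at \<open>H\<close> makes it the kernel of \<open>\<phi>\<close>, which is
  automatically closed under the operations.
\<close>

definition extension :: "('f, 'r) ring_scheme \<Rightarrow> 'h set \<Rightarrow> ('f, 'h) dialgebra \<Rightarrow>
    ('h \<Rightarrow> 'l) \<Rightarrow> ('f, 'l) dialgebra \<Rightarrow> bool" where
  "extension F A H \<phi> L \<longleftrightarrow> diassociative_algebra F H \<and> diassociative_algebra F L \<and>
     \<phi> \<in> dia_hom F H L \<and> A = a_kernel H L \<phi> \<and> \<phi> ` carrier H = carrier L"

definition central_extension :: "('f, 'r) ring_scheme \<Rightarrow> 'h set \<Rightarrow> ('f, 'h) dialgebra \<Rightarrow>
    ('h \<Rightarrow> 'l) \<Rightarrow> ('f, 'l) dialgebra \<Rightarrow> bool" where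
  "central_extension F A H \<phi> L \<longleftrightarrow> extension F A H \<phi> L \<and> A \<subseteq> dia_center H"

definition covering_homs :: "('f, 'r) ring_scheme \<Rightarrow> ('f, 'h) dialgebra \<Rightarrow> ('h \<Rightarrow> 'l) \<Rightarrow>
    ('f, 'k) dialgebra \<Rightarrow> ('k \<Rightarrow> 'l) \<Rightarrow> ('h \<Rightarrow> 'k) set" where
  "covering_homs F H \<phi> H\<^sub>1 \<phi>\<^sub>1 = {\<tau> \<in> dia_hom F H H\<^sub>1. \<forall>x\<in>carrier H. \<phi>\<^sub>1 (\<tau> x) = \<phi> x}"

text \<open>Homomorphisms are HOL functions, hence unique only up to their values outside the carrier.\<close>

definition uniquely_covers :: "('f, 'r) ring_scheme \<Rightarrow> ('f, 'h) dialgebra \<Rightarrow> ('h \<Rightarrow> 'l) \<Rightarrow>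
    ('f, 'k) dialgebra \<Rightarrow> ('k \<Rightarrow> 'l) \<Rightarrow> bool" where
  "uniquely_covers F H \<phi> H\<^sub>1 \<phi>\<^sub>1 \<longleftrightarrow>
     (\<exists>\<tau> \<in> covering_homs F H \<phi> H\<^sub>1 \<phi>\<^sub>1.
        \<forall>\<sigma> \<in> covering_homs F H \<phi> H\<^sub>1 \<phi>\<^sub>1. \<forall>x\<in>carrier H. \<sigma> x = \<tau> x)"

text \<open>
  A HOL formula cannot quantify over the type of the carrier of \<open>H\<^sub>1\<close>. The definition uses one
  sufficiently large type; the theorem \<open>universal_central_extension_uniquely_covers\<close> below shows
  that unique covering of all central extensions of \<open>L\<close> over any other type follows.
\<close>

definition universal_central_extension :: "('f, 'r) ring_scheme \<Rightarrow> 'h set \<Rightarrow> ('f, 'h) dialgebra \<Rightarrow>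
    ('h \<Rightarrow> 'l) \<Rightarrow> ('f, 'l) dialgebra \<Rightarrow> bool" where
  "universal_central_extension F A H \<phi> L \<longleftrightarrow> central_extension F A H \<phi> L \<and>
     (\<forall>A\<^sub>1 (H\<^sub>1 :: ('f, ('f + 'h + 'l) list) dialgebra) \<phi>\<^sub>1.
        central_extension F A\<^sub>1 H\<^sub>1 \<phi>\<^sub>1 L \<longrightarrow> uniquely_covers F H \<phi> H\<^sub>1 \<phi>\<^sub>1)"


section \<open>Independence of the carrier type\<close>

lemma dia_homD:
  assumes "h \<in> dia_hom F L M"
  shows "x \<in> carrier L \<Longrightarrow> h x \<in> carrier M"
    and "\<lbrakk>x \<in> carrier L; y \<in> carrier L\<rbrakk> \<Longrightarrow> h (x \<oplus>\<^bsub>L\<^esub> y) = h x \<oplus>\<^bsub>M\<^esub> h y"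
    and "\<lbrakk>c \<in> carrier F; x \<in> carrier L\<rbrakk> \<Longrightarrow> h (c \<odot>\<^bsub>L\<^esub> x) = c \<odot>\<^bsub>M\<^esub> h x"
    and "\<lbrakk>x \<in> carrier L; y \<in> carrier L\<rbrakk> \<Longrightarrow> h (x \<stileturn>\<^bsub>L\<^esub> y) = h x \<stileturn>\<^bsub>M\<^esub> h y"
    and "\<lbrakk>x \<in> carrier L; y \<in> carrier L\<rbrakk> \<Longrightarrow> h (x \<turnstile>\<^bsub>L\<^esub> y) = h x \<turnstile>\<^bsub>M\<^esub> h y"
  using assms unfolding dia_hom_def by blast+

lemma dia_hom_zero:
  assumes "h \<in> dia_hom F L M" "diassociative_algebra F L" "diassociative_algebra F M"
  shows "h \<zero>\<^bsub>L\<^esub> = \<zero>\<^bsub>M\<^esub>"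
proof -
  interpret L: diassociative_algebra F L by fact
  interpret M: diassociative_algebra F M by fact
  have "h \<zero>\<^bsub>L\<^esub> = h (\<zero>\<^bsub>F\<^esub> \<odot>\<^bsub>L\<^esub> \<zero>\<^bsub>L\<^esub>)" by simp
  also have "\<dots> = \<zero>\<^bsub>F\<^esub> \<odot>\<^bsub>M\<^esub> h \<zero>\<^bsub>L\<^esub>"
    using assms(1) by (intro dia_homD(3)) auto
  also have "\<dots> = \<zero>\<^bsub>M\<^esub>" using dia_homD(1)[OF assms(1)] by simp
  finally show ?thesis .
qed

definition transport :: "('a \<Rightarrow> 'b) \<Rightarrow> 'a set \<Rightarrow> ('f, 'a) dialgebra \<Rightarrow> ('f, 'b) dialgebra" where
  "transport e K M = (let g = inv_into K e in
     \<lparr>carrier = e ` K, mult = undefined, one = undefined, zero = e \<zero>\<^bsub>M\<^esub>,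
      add = \<lambda>u v. e (g u \<oplus>\<^bsub>M\<^esub> g v), smult = \<lambda>c u. e (c \<odot>\<^bsub>M\<^esub> g u),
      lprod = \<lambda>u v. e (g u \<stileturn>\<^bsub>M\<^esub> g v), rprod = \<lambda>u v. e (g u \<turnstile>\<^bsub>M\<^esub> g v)\<rparr>)"

locale small_subextension =
  fixes F :: "('f, 'r) ring_scheme" and A :: "'a set" and M :: "('f, 'a) dialgebra"
    and \<psi> :: "'a \<Rightarrow> 'l" and L :: "('f, 'l) dialgebra" and K :: "'a set" and e :: "'a \<Rightarrow> 'b"
  assumes ext: "central_extension F A M \<psi> L"
    and sub: "submodule K F M"
    and l_closed: "\<And>x y. \<lbrakk>x \<in> K; y \<in> K\<rbrakk> \<Longrightarrow> x \<stileturn>\<^bsub>M\<^esub> y \<in> K"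
    and r_closed: "\<And>x y. \<lbrakk>x \<in> K; y \<in> K\<rbrakk> \<Longrightarrow> x \<turnstile>\<^bsub>M\<^esub> y \<in> K"
    and onto: "\<psi> ` K = carrier L"
    and inj: "inj_on e K"
begin

abbreviation "N \<equiv> transport e K M"

lemma M_dia: "diassociative_algebra F M" and L_dia: "diassociative_algebra F L"
  and hom: "\<psi> \<in> dia_hom F M L"
  using ext unfolding central_extension_def extension_def by auto

sublocale M: diassociative_algebra F M by (rule M_dia)

lemma K_carrier: "x \<in> K \<Longrightarrow> x \<in> carrier M"
  using M.submoduleE(1)[OF sub] by auto

lemma K_closed: "\<zero>\<^bsub>M\<^esub> \<in> K" "x \<in> K \<Longrightarrow> y \<in> K \<Longrightarrow> x \<oplus>\<^bsub>M\<^esub> y \<in> K" "x \<in> K \<Longrightarrow> \<ominus>\<^bsub>M\<^esub> x \<in> K"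
  "c \<in> carrier F \<Longrightarrow> x \<in> K \<Longrightarrow> c \<odot>\<^bsub>M\<^esub> x \<in> K"
  using M.submoduleE[OF sub] subgroup.one_closed[OF submodule.axioms(1)[OF sub]] by auto

lemma N_simps:
  "carrier N = e ` K" "\<zero>\<^bsub>N\<^esub> = e \<zero>\<^bsub>M\<^esub>"
  "x \<in> K \<Longrightarrow> y \<in> K \<Longrightarrow> e x \<oplus>\<^bsub>N\<^esub> e y = e (x \<oplus>\<^bsub>M\<^esub> y)"
  "x \<in> K \<Longrightarrow> c \<odot>\<^bsub>N\<^esub> e x = e (c \<odot>\<^bsub>M\<^esub> x)"
  "x \<in> K \<Longrightarrow> y \<in> K \<Longrightarrow> e x \<stileturn>\<^bsub>N\<^esub> e y = e (x \<stileturn>\<^bsub>M\<^esub> y)"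
  "x \<in> K \<Longrightarrow> y \<in> K \<Longrightarrow> e x \<turnstile>\<^bsub>N\<^esub> e y = e (x \<turnstile>\<^bsub>M\<^esub> y)"
  using inj by (auto simp: transport_def Let_def)

lemmas K_simps = N_simps K_carrier K_closed l_closed r_closed

lemma N_dia: "diassociative_algebra F N"
proof -
  have "abelian_group N"
  proof (rule abelian_groupI)
    fix u assume "u \<in> carrier N"
    then obtain x where x: "x \<in> K" "u = e x" by (auto simp: N_simps)
    then have "e (\<ominus>\<^bsub>M\<^esub> x) \<in> carrier N \<and> e (\<ominus>\<^bsub>M\<^esub> x) \<oplus>\<^bsub>N\<^esub> u = \<zero>\<^bsub>N\<^esub>"
      by (simp add: K_simps M.l_neg)
    then show "\<exists>y\<in>carrier N. y \<oplus>\<^bsub>N\<^esub> u = \<zero>\<^bsub>N\<^esub>" by blast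
  next
    fix u v assume "u \<in> carrier N" "v \<in> carrier N"
    then obtain x y where xy: "x \<in> K" "u = e x" "y \<in> K" "v = e y" by (auto simp: N_simps)
    then have "x \<oplus>\<^bsub>M\<^esub> y = y \<oplus>\<^bsub>M\<^esub> x" by (intro M.a_comm K_carrier)
    then show "u \<oplus>\<^bsub>N\<^esub> v = v \<oplus>\<^bsub>N\<^esub> u"
      using xy by (simp add: N_simps)
  qed (auto simp: K_simps M.a_assoc)
  then have "module F N"
    by (intro moduleI M.is_cring)
      (auto simp: K_simps M.smult_l_distr M.smult_r_distr M.smult_assoc1)
  then show ?thesis
    by (intro diassociative_algebra.intro diassociative_algebra_axioms.intro M.field_axioms)
      (auto simp: K_simps M.lprod_add_left M.lprod_add_right M.rprod_add_left M.rprod_add_right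
        M.lprod_smult_left M.lprod_smult_right M.rprod_smult_left M.rprod_smult_right
        M.lprod_assoc M.rprod_assoc M.rprod_lprod_assoc
        M.lprod_lprod_eq_lprod_rprod[symmetric] M.lprod_rprod_eq_rprod_rprod)
qed

lemma N_ext: "central_extension F (a_kernel N L (\<psi> \<circ> inv_into K e)) N (\<psi> \<circ> inv_into K e) L"
proof -
  have A: "A = a_kernel M L \<psi>" "A \<subseteq> dia_center M"
    using ext unfolding central_extension_def extension_def by auto
  have "\<psi> \<circ> inv_into K e \<in> dia_hom F N L"
    using inj by (auto simp: dia_hom_def K_simps dia_homD[OF hom])
  moreover have "(\<psi> \<circ> inv_into K e) ` carrier N = carrier L"
    using onto inj by (auto simp: N_simps image_comp)
  moreover have "a_kernel N L (\<psi> \<circ> inv_into K e) \<subseteq> dia_center N"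
  proof
    fix u assume u: "u \<in> a_kernel N L (\<psi> \<circ> inv_into K e)"
    then obtain x where x: "x \<in> K" "u = e x" by (auto simp: a_kernel_defs N_simps)
    then have "x \<in> A"
      using u inj by (auto simp: A a_kernel_defs K_carrier)
    then show "u \<in> dia_center N"
      using x A(2) by (auto simp: dia_center_def K_simps)
  qed
  ultimately show ?thesis
    using N_dia L_dia unfolding central_extension_def extension_def by auto
qed

lemma from_N: "\<tau> \<in> covering_homs F H \<phi> N (\<psi> \<circ> inv_into K e)
    \<Longrightarrow> inv_into K e \<circ> \<tau> \<in> covering_homs F H \<phi> M \<psi>"
proof -
  assume \<tau>: "\<tau> \<in> covering_homs F H \<phi> N (\<psi> \<circ> inv_into K e)"
  then have \<tau>h: "\<tau> \<in> dia_hom F H N" by (auto simp: covering_homs_def)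
  have g: "inv_into K e \<in> dia_hom F N M"
    using inj by (auto simp: dia_hom_def K_simps)
  show ?thesis
    using \<tau> by (auto simp: covering_homs_def dia_hom_def[of F H M] dia_homD[OF \<tau>h] dia_homD[OF g])
qed

lemma to_N:
  assumes \<tau>: "\<tau> \<in> covering_homs F H \<phi> M \<psi>" and im: "\<tau> ` carrier H \<subseteq> K"
  shows "e \<circ> \<tau> \<in> covering_homs F H \<phi> N (\<psi> \<circ> inv_into K e)"
proof -
  have \<tau>h: "\<tau> \<in> dia_hom F H M" using \<tau> by (auto simp: covering_homs_def)
  have K: "x \<in> carrier H \<Longrightarrow> \<tau> x \<in> K" for x using im by auto
  show ?thesis
    using \<tau> inj by (auto simp: covering_homs_def dia_hom_def[of F H N] K K_simps dia_homD[OF \<tau>h])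
qed

end

text \<open>
  Linear combinations of \<open>s a\<close>, \<open>s a \<stileturn> s b\<close>, \<open>s a \<turnstile> s b\<close>, for a section \<open>s\<close> of a central
  extension, together with a coding of them by lists.
\<close>

inductive_set section_span ::
    "('f, 'r) ring_scheme \<Rightarrow> ('f, 'a) dialgebra \<Rightarrow> 'l set \<Rightarrow> ('l \<Rightarrow> 'a) \<Rightarrow> 'a set"
  for F :: "('f, 'r) ring_scheme" and M :: "('f, 'a) dialgebra" and C :: "'l set"
    and s :: "'l \<Rightarrow> 'a" where
  zero: "\<zero>\<^bsub>M\<^esub> \<in> section_span F M C s"
| sect: "\<lbrakk>c \<in> carrier F; a \<in> C; x \<in> section_span F M C s\<rbrakk>
    \<Longrightarrow> (c \<odot>\<^bsub>M\<^esub> s a) \<oplus>\<^bsub>M\<^esub> x \<in> section_span F M C s"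
| lpr: "\<lbrakk>c \<in> carrier F; a \<in> C; b \<in> C; x \<in> section_span F M C s\<rbrakk>
    \<Longrightarrow> (c \<odot>\<^bsub>M\<^esub> (s a \<stileturn>\<^bsub>M\<^esub> s b)) \<oplus>\<^bsub>M\<^esub> x \<in> section_span F M C s"
| rpr: "\<lbrakk>c \<in> carrier F; a \<in> C; b \<in> C; x \<in> section_span F M C s\<rbrakk>
    \<Longrightarrow> (c \<odot>\<^bsub>M\<^esub> (s a \<turnstile>\<^bsub>M\<^esub> s b)) \<oplus>\<^bsub>M\<^esub> x \<in> section_span F M C s"

fun decode :: "('f, 'a) dialgebra \<Rightarrow> ('l \<Rightarrow> 'a) \<Rightarrow> ('f + 'h + 'l) list \<Rightarrow> 'a" where
  "decode M s (Inl c # Inr (Inr a) # w) = (c \<odot>\<^bsub>M\<^esub> s a) \<oplus>\<^bsub>M\<^esub> decode M s w"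
| "decode M s (Inl c # Inl d # Inr (Inr a) # Inr (Inr b) # w) =
     (c \<odot>\<^bsub>M\<^esub> (s a \<stileturn>\<^bsub>M\<^esub> s b)) \<oplus>\<^bsub>M\<^esub> decode M s w"
| "decode M s (Inl c # Inl d # Inl d' # Inr (Inr a) # Inr (Inr b) # w) =
     (c \<odot>\<^bsub>M\<^esub> (s a \<turnstile>\<^bsub>M\<^esub> s b)) \<oplus>\<^bsub>M\<^esub> decode M s w"
| "decode M s _ = \<zero>\<^bsub>M\<^esub>"

lemma section_span_decode:
  fixes M :: "('f, 'a) dialgebra" and s :: "'l \<Rightarrow> 'a"
  shows "x \<in> section_span F M C s \<Longrightarrow> x \<in> range (decode M s :: ('f + 'h + 'l) list \<Rightarrow> 'a)"
proof (induction rule: section_span.induct)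
  case zero
  show ?case by (rule range_eqI[of _ _ "[]"]) simp
next
  case (sect c a x)
  then obtain w :: "('f + 'h + 'l) list" where "x = decode M s w" by auto
  then show ?case by (intro range_eqI[of _ _ "Inl c # Inr (Inr a) # w"]) simp
next
  case (lpr c a b x)
  then obtain w :: "('f + 'h + 'l) list" where "x = decode M s w" by auto
  then show ?case
    by (intro range_eqI[of _ _ "Inl c # Inl undefined # Inr (Inr a) # Inr (Inr b) # w"]) simp
next
  case (rpr c a b x)
  then obtain w :: "('f + 'h + 'l) list" where "x = decode M s w" by auto
  then show ?case
    by (intro range_eqI[of _ _ "Inl c # Inl undefined # Inl undefined # Inr (Inr a) # Inr (Inr b) # w"])
      simp
qed

lemma central_extension_prod_cong:
  assumes ext: "central_extension F A M \<psi> L"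
    and xs: "x \<in> carrier M" "x' \<in> carrier M" "\<psi> x = \<psi> x'"
    and ys: "y \<in> carrier M" "y' \<in> carrier M" "\<psi> y = \<psi> y'"
  shows "x \<stileturn>\<^bsub>M\<^esub> y = x' \<stileturn>\<^bsub>M\<^esub> y'" "x \<turnstile>\<^bsub>M\<^esub> y = x' \<turnstile>\<^bsub>M\<^esub> y'"
proof -
  have dia: "diassociative_algebra F M" "diassociative_algebra F L" and hom: "\<psi> \<in> dia_hom F M L"
    and A: "A = a_kernel M L \<psi>" "A \<subseteq> dia_center M"
    using ext unfolding central_extension_def extension_def by auto
  interpret M: diassociative_algebra F M by fact
  interpret L: diassociative_algebra F L by fact
  have split: "\<exists>k \<in> dia_center M. u = v \<oplus>\<^bsub>M\<^esub> k"
    if u: "u \<in> carrier M" and v: "v \<in> carrier M" and uv: "\<psi> u = \<psi> v" for u v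
  proof
    have vm: "\<ominus>\<^bsub>M\<^esub> v \<in> carrier M" using v by simp
    have \<psi>v: "\<psi> v \<in> carrier L" using dia_homD(1)[OF hom v] .
    have "\<psi> (\<ominus>\<^bsub>M\<^esub> v \<oplus>\<^bsub>M\<^esub> u) = \<psi> (\<ominus>\<^bsub>M\<^esub> v) \<oplus>\<^bsub>L\<^esub> \<psi> v"
      using dia_homD(2)[OF hom vm u] uv by simp
    also have "\<dots> = \<psi> (\<ominus>\<^bsub>M\<^esub> v \<oplus>\<^bsub>M\<^esub> v)" using dia_homD(2)[OF hom vm v] by simp
    also have "\<dots> = \<zero>\<^bsub>L\<^esub>" using v dia_hom_zero[OF hom dia] by (simp add: M.l_neg)
    finally show "\<ominus>\<^bsub>M\<^esub> v \<oplus>\<^bsub>M\<^esub> u \<in> dia_center M" using A u v by (auto simp: a_kernel_defs)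
    show "u = v \<oplus>\<^bsub>M\<^esub> (\<ominus>\<^bsub>M\<^esub> v \<oplus>\<^bsub>M\<^esub> u)" using u v by (simp add: M.r_neg2)
  qed
  obtain k where k: "k \<in> dia_center M" "x = x' \<oplus>\<^bsub>M\<^esub> k" using split xs by blast
  obtain l where l: "l \<in> dia_center M" "y = y' \<oplus>\<^bsub>M\<^esub> l" using split ys by blast
  have c: "k \<in> carrier M" "l \<in> carrier M" using k l by (auto simp: dia_center_def)
  have z: "\<And>w. w \<in> carrier M \<Longrightarrow> k \<stileturn>\<^bsub>M\<^esub> w = \<zero>\<^bsub>M\<^esub>" "\<And>w. w \<in> carrier M \<Longrightarrow> k \<turnstile>\<^bsub>M\<^esub> w = \<zero>\<^bsub>M\<^esub>"
    "\<And>w. w \<in> carrier M \<Longrightarrow> w \<stileturn>\<^bsub>M\<^esub> l = \<zero>\<^bsub>M\<^esub>" "\<And>w. w \<in> carrier M \<Longrightarrow> w \<turnstile>\<^bsub>M\<^esub> l = \<zero>\<^bsub>M\<^esub>"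
    using k l by (auto simp: dia_center_def)
  show "x \<stileturn>\<^bsub>M\<^esub> y = x' \<stileturn>\<^bsub>M\<^esub> y'" "x \<turnstile>\<^bsub>M\<^esub> y = x' \<turnstile>\<^bsub>M\<^esub> y'"
    using xs ys c z unfolding k(2) l(2)
    by (simp_all add: M.lprod_add_left M.lprod_add_right M.rprod_add_left M.rprod_add_right
        M.lprod_closed M.rprod_closed)
qed

lemma covering_exists:
  fixes F :: "('f, 'r) ring_scheme" and H :: "('f, 'h) dialgebra" and \<phi> :: "'h \<Rightarrow> 'l"
    and M :: "('f, 'a) dialgebra"
  assumes univ: "universal_central_extension F A H \<phi> L" and ext: "central_extension F B M \<psi> L"
  shows "covering_homs F H \<phi> M \<psi> \<noteq> {}"
proof -
  have dia: "diassociative_algebra F M" and hom: "\<psi> \<in> dia_hom F M L"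
    and onto: "\<psi> ` carrier M = carrier L"
    using ext unfolding central_extension_def extension_def by auto
  interpret M: diassociative_algebra F M by fact
  define s where "s = inv_into (carrier M) \<psi>"
  have s: "a \<in> carrier L \<Longrightarrow> s a \<in> carrier M" "a \<in> carrier L \<Longrightarrow> \<psi> (s a) = a" for a
    unfolding s_def using onto by (auto intro: inv_into_into f_inv_into_f)
  define K where "K = section_span F M (carrier L) s"
  define e :: "'a \<Rightarrow> ('f + 'h + 'l) list" where "e = inv_into UNIV (decode M s)"
  have sub: "x \<in> carrier M" if "x \<in> K" for x
    using that unfolding K_def
    by induction (auto simp: s M.lprod_closed M.rprod_closed)
  have smul: "d \<odot>\<^bsub>M\<^esub> x \<in> K" if "d \<in> carrier F" "x \<in> K" for d x
    using that(2) unfolding K_def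
  proof induction
    case zero
    then show ?case using that(1) by (simp add: section_span.zero)
  next
    case (sect c a x)
    then show ?case using that(1) section_span.sect[of "d \<otimes>\<^bsub>F\<^esub> c" F a "carrier L" "d \<odot>\<^bsub>M\<^esub> x" M s] sub[unfolded K_def]
      by (simp add: M.smult_r_distr M.smult_assoc1 s)
  next
    case (lpr c a b x)
    then show ?case using that(1) section_span.lpr[of "d \<otimes>\<^bsub>F\<^esub> c" F a "carrier L" b "d \<odot>\<^bsub>M\<^esub> x" M s] sub[unfolded K_def]
      by (simp add: M.smult_r_distr M.smult_assoc1 s M.lprod_closed)
  next
    case (rpr c a b x)
    then show ?case using that(1) section_span.rpr[of "d \<otimes>\<^bsub>F\<^esub> c" F a "carrier L" b "d \<odot>\<^bsub>M\<^esub> x" M s] sub[unfolded K_def]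
      by (simp add: M.smult_r_distr M.smult_assoc1 s M.rprod_closed)
  qed
  have add: "x \<oplus>\<^bsub>M\<^esub> y \<in> K" if "x \<in> K" "y \<in> K" for x y
    using that(1) unfolding K_def
    by induction
      (use that(2) sub in \<open>auto simp: K_def M.a_assoc s M.lprod_closed M.rprod_closed
         intro: section_span.intros\<close>)
  have neg: "\<ominus>\<^bsub>M\<^esub> x \<in> K" if "x \<in> K" for x
    using smul[of "\<ominus>\<^bsub>F\<^esub> \<one>\<^bsub>F\<^esub>" x] that sub[OF that] by (simp add: M.smult_l_minus)
  have prods: "x \<stileturn>\<^bsub>M\<^esub> y \<in> K" "x \<turnstile>\<^bsub>M\<^esub> y \<in> K" if xy: "x \<in> carrier M" "y \<in> carrier M" for x y
  proof -
    have L: "\<psi> x \<in> carrier L" "\<psi> y \<in> carrier L" using onto xy by auto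
    have "x \<stileturn>\<^bsub>M\<^esub> y = s (\<psi> x) \<stileturn>\<^bsub>M\<^esub> s (\<psi> y)" "x \<turnstile>\<^bsub>M\<^esub> y = s (\<psi> x) \<turnstile>\<^bsub>M\<^esub> s (\<psi> y)"
      using central_extension_prod_cong[OF ext, of x "s (\<psi> x)" y "s (\<psi> y)"] xy L s by auto
    then show "x \<stileturn>\<^bsub>M\<^esub> y \<in> K" "x \<turnstile>\<^bsub>M\<^esub> y \<in> K"
      using section_span.lpr[OF M.one_closed L section_span.zero, of M s]
        section_span.rpr[OF M.one_closed L section_span.zero, of M s] L
      by (simp_all add: K_def s M.lprod_closed M.rprod_closed)
  qed
  have sK: "s a \<in> K" if "a \<in> carrier L" for a
    using section_span.sect[OF M.one_closed that section_span.zero, of M s] that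
    by (simp add: K_def s)
  interpret small_subextension F B M \<psi> L K e
  proof (rule small_subextension.intro)
    show "central_extension F B M \<psi> L" by fact
    show "inj_on e K"
      unfolding e_def by (rule inj_on_inv_into) (auto simp: K_def intro: section_span_decode)
    show "\<psi> ` K = carrier L"
    proof
      show "\<psi> ` K \<subseteq> carrier L" using sub onto by blast
      show "carrier L \<subseteq> \<psi> ` K" using s(2) sK by (metis image_eqI subsetI)
    qed
    show "submodule K F M"
      using sub smul add neg by (intro M.submoduleI) (auto simp: K_def intro: section_span.zero)
  qed (use sub prods in auto)
  show ?thesis
    using univ N_ext from_N unfolding universal_central_extension_def uniquely_covers_def by blast
qed

lemma covering_unique:
  fixes F :: "('f, 'r) ring_scheme" and H :: "('f, 'h) dialgebra" and \<phi> :: "'h \<Rightarrow> 'l"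
    and M :: "('f, 'a) dialgebra"
  assumes univ: "universal_central_extension F A H \<phi> L" and ext: "central_extension F B M \<psi> L"
    and \<sigma>: "\<sigma> \<in> covering_homs F H \<phi> M \<psi>" and \<tau>: "\<tau> \<in> covering_homs F H \<phi> M \<psi>"
    and h: "h \<in> carrier H"
  shows "\<sigma> h = \<tau> h"
proof -
  have dia: "diassociative_algebra F M" and hom: "\<psi> \<in> dia_hom F M L"
    and onto: "\<psi> ` carrier M = carrier L"
    using ext unfolding central_extension_def extension_def by auto
  have diaH: "diassociative_algebra F H" and ontoH: "\<phi> ` carrier H = carrier L"
    using univ unfolding universal_central_extension_def central_extension_def extension_def by auto
  interpret M: diassociative_algebra F M by fact
  interpret H: diassociative_algebra F H by fact
  have \<sigma>h: "\<sigma> \<in> dia_hom F H M" "\<And>x. x \<in> carrier H \<Longrightarrow> \<psi> (\<sigma> x) = \<phi> x"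
    and \<tau>h: "\<tau> \<in> dia_hom F H M" "\<And>x. x \<in> carrier H \<Longrightarrow> \<psi> (\<tau> x) = \<phi> x"
    using \<sigma> \<tau> by (auto simp: covering_homs_def)
  define K where "K = {\<sigma> x \<oplus>\<^bsub>M\<^esub> \<tau> y | x y. x \<in> carrier H \<and> y \<in> carrier H}"
  define d :: "('f + 'h + 'l) list \<Rightarrow> 'a" where
    "d w = (case w of [Inr (Inl x), Inr (Inl y)] \<Rightarrow> \<sigma> x \<oplus>\<^bsub>M\<^esub> \<tau> y)" for w
  define e where "e = inv_into UNIV d"
  note hs = dia_homD[OF \<sigma>h(1)] dia_homD[OF \<tau>h(1)]
  have KI: "\<sigma> x \<oplus>\<^bsub>M\<^esub> \<tau> y \<in> K" if "x \<in> carrier H" "y \<in> carrier H" for x y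
    using that by (auto simp: K_def)
  have zeros: "\<sigma> \<zero>\<^bsub>H\<^esub> = \<zero>\<^bsub>M\<^esub>" "\<tau> \<zero>\<^bsub>H\<^esub> = \<zero>\<^bsub>M\<^esub>"
    using dia_hom_zero \<sigma>h(1) \<tau>h(1) dia diaH by blast+
  have \<sigma>K: "\<sigma> x \<in> K" and \<tau>K: "\<tau> x \<in> K" if "x \<in> carrier H" for x
    using KI[of x "\<zero>\<^bsub>H\<^esub>"] KI[of "\<zero>\<^bsub>H\<^esub>" x] that by (auto simp: zeros hs)
  have sub: "x \<in> carrier M" if "x \<in> K" for x using that by (auto simp: K_def hs)
  have smul: "c \<odot>\<^bsub>M\<^esub> x \<in> K" if "c \<in> carrier F" "x \<in> K" for c x
    using that(2) unfolding K_def
  proof clarify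
    fix x y assume "x \<in> carrier H" "y \<in> carrier H"
    then show "\<exists>x' y'. c \<odot>\<^bsub>M\<^esub> (\<sigma> x \<oplus>\<^bsub>M\<^esub> \<tau> y) = \<sigma> x' \<oplus>\<^bsub>M\<^esub> \<tau> y' \<and> x' \<in> carrier H \<and> y' \<in> carrier H"
      using that(1)
      by (intro exI[of _ "c \<odot>\<^bsub>H\<^esub> x"] exI[of _ "c \<odot>\<^bsub>H\<^esub> y"]) (simp add: hs M.smult_r_distr)
  qed
  have interchange: "(p \<oplus>\<^bsub>M\<^esub> q) \<oplus>\<^bsub>M\<^esub> (r \<oplus>\<^bsub>M\<^esub> t) = (p \<oplus>\<^bsub>M\<^esub> r) \<oplus>\<^bsub>M\<^esub> (q \<oplus>\<^bsub>M\<^esub> t)"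
    if "p \<in> carrier M" "q \<in> carrier M" "r \<in> carrier M" "t \<in> carrier M" for p q r t
    using that by (metis M.a_assoc M.a_lcomm M.a_closed)
  have add: "u \<oplus>\<^bsub>M\<^esub> v \<in> K" if "u \<in> K" "v \<in> K" for u v
  proof -
    obtain x y where xy: "x \<in> carrier H" "y \<in> carrier H" "u = \<sigma> x \<oplus>\<^bsub>M\<^esub> \<tau> y"
      using \<open>u \<in> K\<close> unfolding K_def by blast
    obtain x' y' where xy': "x' \<in> carrier H" "y' \<in> carrier H" "v = \<sigma> x' \<oplus>\<^bsub>M\<^esub> \<tau> y'"
      using \<open>v \<in> K\<close> unfolding K_def by blast
    have "u \<oplus>\<^bsub>M\<^esub> v = \<sigma> (x \<oplus>\<^bsub>H\<^esub> x') \<oplus>\<^bsub>M\<^esub> \<tau> (y \<oplus>\<^bsub>H\<^esub> y')"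
      unfolding xy(3) xy'(3) using interchange[of "\<sigma> x" "\<tau> y" "\<sigma> x'" "\<tau> y'"] xy(1,2) xy'(1,2)
      by (simp add: hs)
    then show ?thesis using KI xy(1,2) xy'(1,2) by simp
  qed
  have neg: "\<ominus>\<^bsub>M\<^esub> x \<in> K" if "x \<in> K" for x
    using smul[of "\<ominus>\<^bsub>F\<^esub> \<one>\<^bsub>F\<^esub>" x] that sub[OF that] by (simp add: M.smult_l_minus)
  have prods: "x \<stileturn>\<^bsub>M\<^esub> y \<in> K" "x \<turnstile>\<^bsub>M\<^esub> y \<in> K" if xy: "x \<in> carrier M" "y \<in> carrier M" for x y
  proof -
    have "\<psi> x \<in> \<phi> ` carrier H" "\<psi> y \<in> \<phi> ` carrier H" using onto ontoH xy by auto
    then obtain p q where pq: "p \<in> carrier H" "q \<in> carrier H" "\<psi> x = \<phi> p" "\<psi> y = \<phi> q" by auto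
    have "x \<stileturn>\<^bsub>M\<^esub> y = \<sigma> p \<stileturn>\<^bsub>M\<^esub> \<sigma> q" "x \<turnstile>\<^bsub>M\<^esub> y = \<sigma> p \<turnstile>\<^bsub>M\<^esub> \<sigma> q"
      using central_extension_prod_cong[OF ext, of x "\<sigma> p" y "\<sigma> q"] xy pq \<sigma>h hs by auto
    then show "x \<stileturn>\<^bsub>M\<^esub> y \<in> K" "x \<turnstile>\<^bsub>M\<^esub> y \<in> K"
      using \<sigma>K[OF H.lprod_closed[OF pq(1,2)]] \<sigma>K[OF H.rprod_closed[OF pq(1,2)]] pq
      by (simp_all add: hs)
  qed
  interpret small_subextension F B M \<psi> L K e
  proof (rule small_subextension.intro)
    show "central_extension F B M \<psi> L" by fact
    have "K \<subseteq> range d"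
    proof
      fix u assume "u \<in> K"
      then obtain x y where "u = \<sigma> x \<oplus>\<^bsub>M\<^esub> \<tau> y" by (auto simp: K_def)
      then have "u = d [Inr (Inl x), Inr (Inl y)]" by (simp add: d_def)
      then show "u \<in> range d" by blast
    qed
    then show "inj_on e K" unfolding e_def by (rule inj_on_inv_into)
    show "\<psi> ` K = carrier L"
    proof
      show "\<psi> ` K \<subseteq> carrier L" using sub onto by blast
      show "carrier L \<subseteq> \<psi> ` K"
      proof
        fix a assume "a \<in> carrier L"
        then obtain x where "x \<in> carrier H" "\<phi> x = a" unfolding ontoH[symmetric] by blast
        then show "a \<in> \<psi> ` K" using \<sigma>K \<sigma>h(2) by (metis image_eqI)
      qed
    qed
    have "\<zero>\<^bsub>M\<^esub> \<in> K" using \<sigma>K[of "\<zero>\<^bsub>H\<^esub>"] zeros by simp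
    then show "submodule K F M"
      using sub smul add neg by (intro M.submoduleI) auto
  qed (use sub prods in auto)
  have "e \<circ> \<sigma> \<in> covering_homs F H \<phi> N (\<psi> \<circ> inv_into K e)"
       "e \<circ> \<tau> \<in> covering_homs F H \<phi> N (\<psi> \<circ> inv_into K e)"
    using to_N \<sigma> \<tau> \<sigma>K \<tau>K by blast+
  moreover have "uniquely_covers F H \<phi> N (\<psi> \<circ> inv_into K e)"
    using univ N_ext unfolding universal_central_extension_def by blast
  ultimately have "(e \<circ> \<sigma>) h = (e \<circ> \<tau>) h"
    using h unfolding uniquely_covers_def by metis
  then show ?thesis using inj \<sigma>K[OF h] \<tau>K[OF h] by (auto dest: inj_onD)
qed

theorem universal_central_extension_uniquely_covers:
  fixes H\<^sub>1 :: "('f, 'a) dialgebra"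
  assumes "universal_central_extension F A H \<phi> L" and "central_extension F A\<^sub>1 H\<^sub>1 \<phi>\<^sub>1 L"
  shows "uniquely_covers F H \<phi> H\<^sub>1 \<phi>\<^sub>1"
  using covering_exists[OF assms] covering_unique[OF assms] unfolding uniquely_covers_def by blast

end

theory Submission
  imports Defs
begin

text \<open>
  Let \<open>N\<close> be a subspace of \<open>H\<close> that contains all products. Let products vanish on the quotient space
  \<open>H/N\<close>. Then \<open>L \<times> H/N\<close>, with the first projection, is a central extension of \<open>L\<close>. Both
  \<open>h \<mapsto> (\<phi> h, 0)\<close> and \<open>h \<mapsto> (\<phi> h, h + N)\<close> are homomorphisms over \<open>L\<close>: the second preserves products
  because both sides have second component \<open>0\<close>, a product in \<open>H\<close> lying in \<open>N\<close>. Universality of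
  \<open>H\<close> forces the two maps to agree, so \<open>h + N = 0\<close> for all \<open>h\<close>, that is, \<open>N = H\<close>. As \<open>N\<close> was
  arbitrary, \<open>H\<close> is perfect. Perfectness passes to the homomorphic image \<open>L\<close>.

  Working with an arbitrary \<open>N\<close> instead of the span of the products avoids any description of that
  span; working with \<open>H/N\<close> itself instead of a linear functional on it avoids choosing bases.
\<close>

section \<open>Quotient modules\<close>

text \<open>
  For a coset \<open>X\<close>, the sets in the union that defines scalar multiplication all coincide, so the
  union is the coset of \<open>c \<odot> x\<close> for any representative \<open>x\<close> of \<open>X\<close>.
\<close>

definition quotient_module ::
  "('f, 'a, 'm) module_scheme \<Rightarrow> 'a set \<Rightarrow> ('f, 'a set) module" where
  "quotient_module M N = \<lparr>carrier = a_rcosets\<^bsub>M\<^esub> N, mult = undefined, one = undefined,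
     zero = N, add = (<+>\<^bsub>M\<^esub>), smult = \<lambda>c X. \<Union>x\<in>X. N +>\<^bsub>M\<^esub> (c \<odot>\<^bsub>M\<^esub> x)\<rparr>"

context module
begin

lemma submodule_abelian_subgroup: "submodule N R M \<Longrightarrow> abelian_subgroup N M"
  by (intro abelian_subgroupI3 additive_subgroupI submodule.axioms(1) M.abelian_group_axioms)

lemma quotient_module_carrier:
  "carrier (quotient_module M N) = (\<lambda>x. N +>\<^bsub>M\<^esub> x) ` carrier M"
  by (auto simp: quotient_module_def A_RCOSETS_def' a_r_coset_def)

lemma quotient_module_zero:
  assumes "submodule N R M"
  shows "\<zero>\<^bsub>quotient_module M N\<^esub> = N +>\<^bsub>M\<^esub> \<zero>\<^bsub>M\<^esub>"
proof -
  interpret N: abelian_subgroup N M using assms by (rule submodule_abelian_subgroup)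
  show ?thesis using N.a_rcos_const[OF N.zero_closed] by (simp add: quotient_module_def)
qed

lemma quotient_module_add:
  assumes "submodule N R M" "x \<in> carrier M" "y \<in> carrier M"
  shows "(N +>\<^bsub>M\<^esub> x) \<oplus>\<^bsub>quotient_module M N\<^esub> (N +>\<^bsub>M\<^esub> y) = N +>\<^bsub>M\<^esub> (x \<oplus>\<^bsub>M\<^esub> y)"
proof -
  interpret N: abelian_subgroup N M using assms(1) by (rule submodule_abelian_subgroup)
  show ?thesis using N.a_rcos_sum assms(2,3) by (simp add: quotient_module_def)
qed

lemma quotient_module_smult:
  assumes N: "submodule N R M" and c: "c \<in> carrier R" and x: "x \<in> carrier M"
  shows "c \<odot>\<^bsub>quotient_module M N\<^esub> (N +>\<^bsub>M\<^esub> x) = N +>\<^bsub>M\<^esub> (c \<odot>\<^bsub>M\<^esub> x)"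
proof -
  interpret N: abelian_subgroup N M using N by (rule submodule_abelian_subgroup)
  have "N +>\<^bsub>M\<^esub> (c \<odot>\<^bsub>M\<^esub> y) = N +>\<^bsub>M\<^esub> (c \<odot>\<^bsub>M\<^esub> x)" if "y \<in> N +>\<^bsub>M\<^esub> x" for y
  proof -
    obtain n where n: "n \<in> N" "y = n \<oplus>\<^bsub>M\<^esub> x" using \<open>y \<in> N +>\<^bsub>M\<^esub> x\<close>
      by (auto simp: a_r_coset_def')
    have nM: "n \<in> carrier M" using n(1) N.a_subset by blast
    have "c \<odot>\<^bsub>M\<^esub> y \<in> N +>\<^bsub>M\<^esub> (c \<odot>\<^bsub>M\<^esub> x)"
      unfolding n(2) smult_r_distr[OF c nM x]
      using N.a_subset submoduleE(4)[OF N c n(1)] c x by (intro a_rcosI) auto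
    then show ?thesis
      using N.a_repr_independence'[of "c \<odot>\<^bsub>M\<^esub> y" "c \<odot>\<^bsub>M\<^esub> x"] c x by auto
  qed
  moreover have "x \<in> N +>\<^bsub>M\<^esub> x" using x by (rule N.a_rcos_self)
  ultimately have "(\<Union>y\<in>N +>\<^bsub>M\<^esub> x. N +>\<^bsub>M\<^esub> (c \<odot>\<^bsub>M\<^esub> y)) = N +>\<^bsub>M\<^esub> (c \<odot>\<^bsub>M\<^esub> x)"
    by (intro SUP_eq_const) blast+
  then show ?thesis by (simp add: quotient_module_def)
qed

lemmas quotient_module_simps =
  quotient_module_carrier quotient_module_zero quotient_module_add quotient_module_smult

lemma quotient_module_is_module:
  assumes N: "submodule N R M"
  shows "module R (quotient_module M N)"
proof (rule moduleI)
  show "abelian_group (quotient_module M N)"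
  proof (rule abelian_groupI)
    fix X assume "X \<in> carrier (quotient_module M N)"
    then obtain x where x: "x \<in> carrier M" "X = N +>\<^bsub>M\<^esub> x"
      by (auto simp: quotient_module_carrier)
    then show "\<exists>Y\<in>carrier (quotient_module M N).
        Y \<oplus>\<^bsub>quotient_module M N\<^esub> X = \<zero>\<^bsub>quotient_module M N\<^esub>"
      by (intro bexI[of _ "N +>\<^bsub>M\<^esub> (\<ominus>\<^bsub>M\<^esub> x)"])
        (simp_all add: quotient_module_simps N M.l_neg)
  qed (auto simp: quotient_module_simps N M.a_ac)
qed (auto simp: quotient_module_simps N R.is_cring smult_l_distr smult_r_distr smult_assoc1)

end


section \<open>Central extensions by a module with zero products\<close>

definition zero_product_sum ::
  "('f, 'l) dialgebra \<Rightarrow> ('f, 'v, 'm) module_scheme \<Rightarrow> ('f, 'l \<times> 'v) dialgebra" where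
  "zero_product_sum L V = \<lparr>carrier = carrier L \<times> carrier V, mult = undefined, one = undefined,
     zero = (\<zero>\<^bsub>L\<^esub>, \<zero>\<^bsub>V\<^esub>), add = \<lambda>(a, u) (b, v). (a \<oplus>\<^bsub>L\<^esub> b, u \<oplus>\<^bsub>V\<^esub> v),
     smult = \<lambda>c (a, u). (c \<odot>\<^bsub>L\<^esub> a, c \<odot>\<^bsub>V\<^esub> u),
     lprod = \<lambda>(a, u) (b, v). (a \<stileturn>\<^bsub>L\<^esub> b, \<zero>\<^bsub>V\<^esub>),
     rprod = \<lambda>(a, u) (b, v). (a \<turnstile>\<^bsub>L\<^esub> b, \<zero>\<^bsub>V\<^esub>)\<rparr>"

lemma zero_product_sum_simps [simp]:
  "carrier (zero_product_sum L V) = carrier L \<times> carrier V"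
  "\<zero>\<^bsub>zero_product_sum L V\<^esub> = (\<zero>\<^bsub>L\<^esub>, \<zero>\<^bsub>V\<^esub>)"
  "(a, u) \<oplus>\<^bsub>zero_product_sum L V\<^esub> (b, v) = (a \<oplus>\<^bsub>L\<^esub> b, u \<oplus>\<^bsub>V\<^esub> v)"
  "c \<odot>\<^bsub>zero_product_sum L V\<^esub> (a, u) = (c \<odot>\<^bsub>L\<^esub> a, c \<odot>\<^bsub>V\<^esub> u)"
  "(a, u) \<stileturn>\<^bsub>zero_product_sum L V\<^esub> (b, v) = (a \<stileturn>\<^bsub>L\<^esub> b, \<zero>\<^bsub>V\<^esub>)"
  "(a, u) \<turnstile>\<^bsub>zero_product_sum L V\<^esub> (b, v) = (a \<turnstile>\<^bsub>L\<^esub> b, \<zero>\<^bsub>V\<^esub>)"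
  by (simp_all add: zero_product_sum_def)

context diassociative_algebra
begin

lemma lprod_zero: "x \<in> carrier L \<Longrightarrow> \<zero>\<^bsub>L\<^esub> \<stileturn> x = \<zero>\<^bsub>L\<^esub>" "x \<in> carrier L \<Longrightarrow> x \<stileturn> \<zero>\<^bsub>L\<^esub> = \<zero>\<^bsub>L\<^esub>"
  using lprod_smult_left[of "\<zero>\<^bsub>F\<^esub>" "\<zero>\<^bsub>L\<^esub>" x] lprod_smult_right[of "\<zero>\<^bsub>F\<^esub>" x "\<zero>\<^bsub>L\<^esub>"]
  by (simp_all add: lprod_closed)

lemma rprod_zero: "x \<in> carrier L \<Longrightarrow> \<zero>\<^bsub>L\<^esub> \<turnstile> x = \<zero>\<^bsub>L\<^esub>" "x \<in> carrier L \<Longrightarrow> x \<turnstile> \<zero>\<^bsub>L\<^esub> = \<zero>\<^bsub>L\<^esub>"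
  using rprod_smult_left[of "\<zero>\<^bsub>F\<^esub>" "\<zero>\<^bsub>L\<^esub>" x] rprod_smult_right[of "\<zero>\<^bsub>F\<^esub>" x "\<zero>\<^bsub>L\<^esub>"]
  by (simp_all add: rprod_closed)

lemma zero_product_sum_diassociative:
  assumes "module F V"
  shows "diassociative_algebra F (zero_product_sum L V)"
proof -
  interpret V: module F V by fact
  have "abelian_group (zero_product_sum L V)"
  proof (rule abelian_groupI)
    fix p assume "p \<in> carrier (zero_product_sum L V)"
    then show "\<exists>q\<in>carrier (zero_product_sum L V).
        q \<oplus>\<^bsub>zero_product_sum L V\<^esub> p = \<zero>\<^bsub>zero_product_sum L V\<^esub>"
      by (intro bexI[of _ "(\<ominus>\<^bsub>L\<^esub> fst p, \<ominus>\<^bsub>V\<^esub> snd p)"]) (auto simp: M.l_neg V.l_neg)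
  qed (auto simp: M.a_ac V.a_ac)
  then have "module F (zero_product_sum L V)"
    by (intro moduleI is_cring)
      (auto simp: smult_l_distr smult_r_distr smult_assoc1
        V.smult_l_distr V.smult_r_distr V.smult_assoc1)
  then show ?thesis
    by (intro diassociative_algebra.intro diassociative_algebra_axioms.intro field_axioms)
      (auto simp: lprod_closed rprod_closed lprod_add_left lprod_add_right rprod_add_left
        rprod_add_right lprod_smult_left lprod_smult_right rprod_smult_left rprod_smult_right
        lprod_assoc rprod_assoc rprod_lprod_assoc
        lprod_lprod_eq_lprod_rprod[symmetric] lprod_rprod_eq_rprod_rprod)
qed

lemma zero_product_sum_central_extension:
  assumes "module F V"
  shows "central_extension F (a_kernel (zero_product_sum L V) L fst) (zero_product_sum L V) fst L"
proof -
  interpret V: module F V by fact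
  have "fst \<in> dia_hom F (zero_product_sum L V) L"
    by (auto simp: dia_hom_def)
  moreover have "fst ` carrier (zero_product_sum L V) = carrier L"
    using V.zero_closed by force
  moreover have "a_kernel (zero_product_sum L V) L fst \<subseteq> dia_center (zero_product_sum L V)"
    by (auto simp: a_kernel_defs dia_center_def lprod_zero rprod_zero)
  ultimately show ?thesis
    unfolding central_extension_def extension_def
    using zero_product_sum_diassociative[OF assms] diassociative_algebra_axioms by blast
qed

end


section \<open>Perfect diassociative algebras\<close>

text \<open>
  Testing perfectness against each subspace separately suits the two arguments below: one divides
  by such a subspace, the other takes its preimage under a homomorphism.
\<close>

lemma (in diassociative_algebra) perfect_iff:
  "perfect F L \<longleftrightarrow> (\<forall>N. submodule N F L \<longrightarrow>
     (\<forall>x\<in>carrier L. \<forall>y\<in>carrier L. x \<stileturn> y \<in> N \<and> x \<turnstile> y \<in> N) \<longrightarrow> carrier L \<subseteq> N)"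
proof -
  have "lozenge F L (carrier L) (carrier L) \<subseteq> carrier L"
    unfolding lozenge_def
    by (rule hull_minimal) (auto simp: lprod_closed rprod_closed carrier_is_submodule)
  then have "perfect F L \<longleftrightarrow> carrier L \<subseteq> lozenge F L (carrier L) (carrier L)"
    unfolding perfect_def by blast
  then show ?thesis unfolding lozenge_def hull_def by blast
qed

text \<open>
  A subspace of \<open>L\<close> containing all products pulls back to a subspace of \<open>H\<close> containing all products.
  The latter is all of \<open>H\<close>, and \<open>\<phi>\<close> is onto.
\<close>

lemma perfect_surj_image:
  assumes perfect: "perfect F H" and H: "diassociative_algebra F H"
    and L: "diassociative_algebra F L" and hom: "\<phi> \<in> dia_hom F H L"
    and onto: "\<phi> ` carrier H = carrier L"
  shows "perfect F L"
proof -
  interpret H: diassociative_algebra F H by fact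
  interpret L: diassociative_algebra F L by fact
  note hom = dia_homD[OF hom] dia_hom_zero[OF hom H L]
  show ?thesis
    unfolding L.perfect_iff
  proof (intro allI impI)
    fix N assume N: "submodule N F L"
      and prods: "\<forall>x\<in>carrier L. \<forall>y\<in>carrier L. x \<stileturn>\<^bsub>L\<^esub> y \<in> N \<and> x \<turnstile>\<^bsub>L\<^esub> y \<in> N"
    define P where "P = {x \<in> carrier H. \<phi> x \<in> N}"
    note N = L.submoduleE[OF N] subgroup.one_closed[OF submodule.axioms(1)[OF N], simplified]
    have smult: "c \<odot>\<^bsub>H\<^esub> x \<in> P" if "c \<in> carrier F" "x \<in> P" for c x
      using that N(4) by (auto simp: P_def hom)
    have "submodule P F H"
    proof (rule H.submoduleI)
      show "\<ominus>\<^bsub>H\<^esub> x \<in> P" if "x \<in> P" for x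
        using smult[of "\<ominus>\<^bsub>F\<^esub> \<one>\<^bsub>F\<^esub>" x] that by (simp add: H.smult_l_minus P_def)
    qed (use smult N in \<open>auto simp: P_def hom\<close>)
    moreover have "x \<stileturn>\<^bsub>H\<^esub> y \<in> P \<and> x \<turnstile>\<^bsub>H\<^esub> y \<in> P" if "x \<in> carrier H" "y \<in> carrier H" for x y
      using that prods by (simp add: P_def hom H.lprod_closed H.rprod_closed)
    ultimately have "carrier H \<subseteq> P"
      using perfect unfolding H.perfect_iff by blast
    then show "carrier L \<subseteq> N"
      unfolding onto[symmetric] by (auto simp: P_def)
  qed
qed


section \<open>Universal central extensions\<close>

text \<open>
  A homomorphism over \<open>L\<close> into \<open>L \<times> H/N\<close> is determined by a linear map \<open>H \<rightarrow> H/N\<close> that vanishes on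
  products. The zero map and the quotient map are two of these, so uniqueness makes them equal.
\<close>

lemma universal_central_extension_perfect:
  assumes univ: "universal_central_extension F A H \<phi> L"
  shows "perfect F H"
proof -
  have H: "diassociative_algebra F H" and L: "diassociative_algebra F L"
    and \<phi>: "\<phi> \<in> dia_hom F H L"
    using univ unfolding universal_central_extension_def central_extension_def extension_def
    by auto
  interpret H: diassociative_algebra F H by fact
  interpret L: diassociative_algebra F L by fact
  note \<phi> = dia_homD[OF \<phi>]
  show ?thesis
    unfolding H.perfect_iff
  proof (intro allI impI)
    fix N assume N: "submodule N F H"
      and prods: "\<forall>x\<in>carrier H. \<forall>y\<in>carrier H. x \<stileturn>\<^bsub>H\<^esub> y \<in> N \<and> x \<turnstile>\<^bsub>H\<^esub> y \<in> N"
    interpret N: abelian_subgroup N H using N by (rule H.submodule_abelian_subgroup)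
    define V where "V = quotient_module H N"
    interpret V: module F V unfolding V_def using N by (rule H.quotient_module_is_module)
    define E where "E = zero_product_sum L V"
    have coset_zero: "N +>\<^bsub>H\<^esub> n = \<zero>\<^bsub>V\<^esub>" if "n \<in> N" for n
      using N.a_rcos_const[OF that] by (simp add: V_def quotient_module_def)
    have "(\<lambda>h. (\<phi> h, \<zero>\<^bsub>V\<^esub>)) \<in> covering_homs F H \<phi> E fst"
      by (auto simp: covering_homs_def dia_hom_def E_def \<phi>)
    moreover have "(\<lambda>h. (\<phi> h, N +>\<^bsub>H\<^esub> h)) \<in> covering_homs F H \<phi> E fst"
      using prods
      by (auto simp: covering_homs_def dia_hom_def E_def \<phi> coset_zero)
        (simp_all add: V_def H.quotient_module_simps N)
    moreover have "uniquely_covers F H \<phi> E fst"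
      using universal_central_extension_uniquely_covers[OF univ]
        L.zero_product_sum_central_extension[OF V.module_axioms]
      unfolding E_def by blast
    ultimately have agree: "(\<phi> h, \<zero>\<^bsub>V\<^esub>) = (\<phi> h, N +>\<^bsub>H\<^esub> h)" if "h \<in> carrier H" for h
      using that unfolding uniquely_covers_def by metis
    show "carrier H \<subseteq> N"
    proof
      fix h assume h: "h \<in> carrier H"
      have "N +>\<^bsub>H\<^esub> h = N" using agree[OF h] by (simp add: V_def quotient_module_def)
      then show "h \<in> N" using N.a_rcos_self[OF h] by simp
    qed
  qed
qed

theorem lemma2p2:
  fixes F :: "('f, 'r) ring_scheme"
    and A :: "'h set" and H :: "('f, 'h) dialgebra"
    and \<phi> :: "'h \<Rightarrow> 'l" and L :: "('f, 'l) dialgebra"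
  assumes "field F"
    and "universal_central_extension F A H \<phi> L"
  shows "perfect F H \<and> perfect F L"
proof
  show "perfect F H" using assms(2) by (rule universal_central_extension_perfect)
  then show "perfect F L"
    using assms(2) perfect_surj_image[of F H L \<phi>]
    unfolding universal_central_extension_def central_extension_def extension_def by blast
qed

end
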